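(* The operator $H_C:\mathcal{C}(T,X)\to\mathcal{C}(T,X)$, defined by $H_C(f)(t)=\int_\Theta (R_\theta\circ f\circ\omega_\theta)(t)\,dW(\theta)$ for $f\in\mathcal{C}(T,X)$ and $t\in T$, is linear and continuous (with respect to $\|\cdot\|_\infty$), and its operator norm satisfies $$\|H_C\|_o\leq\int_\Theta\|R_\theta\|_o\, dW(\theta).$$
   Context: $K$ is $\mathbb{R}$ or $\mathbb{C}$. $(\Theta,\Sigma,W)$ is a measure space, $(T,d)$ is a compact metric space with at least two elements, and $X$ is a non-null Hilbert space over $K$. For a topological space $Z$, $\mathcal{B}_Z$ denotes its Borel $\sigma$-algebra. $\omega:T\times\Theta\to T$ is $(\mathcal{B}_T\otimes\Sigma,\mathcal{B}_T)$-measurable and $R:X\times\Theta\to X$ is $(\mathcal{B}_X\otimes\Sigma,\mathcal{B}_X)$-measurable. For $\theta\in\Theta$ put $\omega_\theta(t)=\omega(t,\theta)$ and $R_\theta(x)=R(x,\theta)$. For every $\theta\in\Theta$: $R_\theta$ is a continuous linear operator on $X$, with operator norm $\|R_\theta\|_o$; and $\omega_\theta:T\to T$ is Lipschitz with (smallest) Lipschitz constant $r_\theta=\sup_{s\ne t} d(\omega_\theta(s),\omega_\theta(t))/d(s,t)<\infty$. The function $\theta\mapsto\|R_\theta\|_o$ is assumed $\Sigma$-measurable ($\theta\mapsto r_\theta$ is then automatically $\Sigma$-measurable), and it is assumed that $\int_\Theta\|R_\theta\|_o(1+r_\theta)\,dW(\theta)<\infty$. $\mathcal{C}(T,X)$ is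 the Banach space of continuous functions $f:T\to X$ with norm $\|f\|_\infty=\sup_{t\in T}\|f(t)\|$. For every $f\in\mathcal{C}(T,X)$ and $t\in T$ the function $\theta\mapsto (R_\theta\circ f\circ\omega_\theta)(t)$ is Bochner integrable with respect to $W$; the integral defining $H_C(f)(t)$ is a Bochner integral, and $H_C(f)$ is a continuous function on $T$. *)

theory Defs
  imports "HOL-Analysis.Analysis"
begin

text \<open>
  A Hilbert space over \<open>K\<close>, where \<open>K\<close> is the real or the complex field, seen as a subfield of the
  complex numbers; for \<open>K = \<real>\<close> the values of \<open>smul\<close> at non-real scalars play no role.
  Additive group, norm, topology and completeness are those of the class \<^class>\<open>banach\<close>;
  the inner product is linear in its first argument and induces the norm.
\<close>

locale hilbert_space_over =
  fixes K :: "complex set"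
    and smul :: "complex \<Rightarrow> 'x::banach \<Rightarrow> 'x"
    and ip :: "'x \<Rightarrow> 'x \<Rightarrow> complex"
  assumes K_real_or_complex: "K = \<real> \<or> K = UNIV"
    and scale_add_right: "a \<in> K \<Longrightarrow> smul a (x + y) = smul a x + smul a y"
    and scale_add_left: "a \<in> K \<Longrightarrow> b \<in> K \<Longrightarrow> smul (a + b) x = smul a x + smul b x"
    and scale_scale: "a \<in> K \<Longrightarrow> b \<in> K \<Longrightarrow> smul a (smul b x) = smul (a * b) x"
    and scale_of_real: "smul (of_real r) x = r *\<^sub>R x"
    and ip_mem: "ip x y \<in> K"
    and ip_add_left: "ip (x + y) z = ip x z + ip y z"
    and ip_scale_left: "a \<in> K \<Longrightarrow> ip (smul a x) y = a * ip x y"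
    and ip_commute: "ip y x = cnj (ip x y)"
    and norm_eq_sqrt_ip: "norm x = sqrt (Re (ip x x))"
begin

lemma ip_self: "ip x x = of_real ((norm x)\<^sup>2)"
proof -
  have "Im (ip x x) = 0"
    using arg_cong[OF ip_commute[of x x], of Im] by simp
  moreover have "0 \<le> Re (ip x x)"
    using norm_eq_sqrt_ip[of x] norm_ge_zero[of x] by simp
  ultimately show ?thesis
    using norm_eq_sqrt_ip[of x] by (simp add: complex_eq_iff)
qed

lemma norm_scale:
  assumes a: "a \<in> K"
  shows "norm (smul a x) = cmod a * norm x"
proof -
  have "ip (smul a x) (smul a x) = a * cnj (ip (smul a x) x)"
    by (simp only: ip_scale_left[OF a, of x "smul a x"] ip_commute[of x "smul a x", symmetric])
  also have "\<dots> = (a * cnj a) * ip x x"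
    by (simp add: ip_scale_left[OF a] ip_self)
  also have "\<dots> = of_real ((cmod a * norm x)\<^sup>2)"
    unfolding ip_self complex_norm_square[symmetric] by (simp add: power_mult_distrib)
  finally have "(norm (smul a x))\<^sup>2 = (cmod a * norm x)\<^sup>2"
    unfolding ip_self of_real_eq_iff .
  then show ?thesis
    by (simp add: power2_eq_iff_nonneg)
qed

end

lemma hilbert_space_over_real:
  "hilbert_space_over \<real> (\<lambda>a x. Re a *\<^sub>R x) (\<lambda>x y :: 'x::{real_inner,banach}. of_real (x \<bullet> y))"
  by unfold_locales
    (auto simp: algebra_simps inner_commute norm_eq_sqrt_inner elim!: Reals_cases)

lemma hilbert_space_over_complex: "hilbert_space_over UNIV (*) (\<lambda>x y. x * cnj y)"
  by unfold_locales
    (auto simp: algebra_simps scaleR_conv_of_real cmod_def power2_eq_square)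

definition linear_over ::
    "complex set \<Rightarrow> (complex \<Rightarrow> 'a::ab_group_add \<Rightarrow> 'a) \<Rightarrow> (complex \<Rightarrow> 'b::ab_group_add \<Rightarrow> 'b)
      \<Rightarrow> ('a \<Rightarrow> 'b) \<Rightarrow> bool" where
  "linear_over K sa sb h \<longleftrightarrow>
    (\<forall>x y. h (x + y) = h x + h y) \<and> (\<forall>a\<in>K. \<forall>x. h (sa a x) = sb a (h x))"

text \<open>
  For compact \<open>T\<close> the type \<open>'t \<Rightarrow>\<^sub>C 'x\<close> of bounded continuous functions with its norm is
  the space of all continuous functions with the supremum norm.
\<close>

lemma compact_bcontfun_eq:
  assumes "compact (UNIV :: 't::topological_space set)"
  shows "(bcontfun :: ('t \<Rightarrow> 'x::metric_space) set) = {f. continuous_on UNIV f}"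
  using assms by (auto simp: bcontfun_def compact_continuous_image compact_imp_bounded)

definition scaleC ::
    "(complex \<Rightarrow> 'x \<Rightarrow> 'x) \<Rightarrow> complex \<Rightarrow> ('t::topological_space \<Rightarrow>\<^sub>C 'x::banach) \<Rightarrow> ('t \<Rightarrow>\<^sub>C 'x)" where
  "scaleC smul a f = Bcontfun (\<lambda>t. smul a (apply_bcontfun f t))"

lemma (in hilbert_space_over) apply_scaleC:
  assumes a: "a \<in> K"
  shows "apply_bcontfun (scaleC smul a f) t = smul a (apply_bcontfun f t)"
proof -
  have "bounded_linear (smul a)"
  proof (rule bounded_linear_intro[where K = "cmod a"])
    show "smul a (r *\<^sub>R x) = r *\<^sub>R smul a x" for r x
    proof -
      have "of_real r \<in> K"
        using K_real_or_complex by auto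
      then show ?thesis
        using scale_scale[OF a, of "of_real r" x] scale_scale[OF _ a, of "of_real r" x]
        by (simp add: scale_of_real mult.commute)
    qed
  qed (auto simp: scale_add_right[OF a] norm_scale[OF a] mult.commute)
  then have "continuous_on UNIV (\<lambda>t. smul a (apply_bcontfun f t))"
    "bounded (smul a ` range (apply_bcontfun f))"
    by (auto intro: bounded_linear.continuous_on bounded_linear_image)
  then have "(\<lambda>t. smul a (apply_bcontfun f t)) \<in> bcontfun"
    by (simp add: bcontfun_def image_image)
  then show ?thesis
    by (simp add: scaleC_def Bcontfun_inverse)
qed

definition lipschitz_const :: "('t::metric_space \<Rightarrow> 't) \<Rightarrow> real" where
  "lipschitz_const h = (SUP (s, t)\<in>{(s, t). s \<noteq> t}. dist (h s) (h t) / dist s t)"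

text \<open>
  The library's Bochner integral is confined to second countable spaces. The following is
  the same definition without that restriction, so that non-separable Hilbert spaces are covered.
\<close>

definition has_bochner :: "'a measure \<Rightarrow> ('a \<Rightarrow> 'x::real_normed_vector) \<Rightarrow> 'x \<Rightarrow> bool" where
  "has_bochner M f x \<longleftrightarrow> f \<in> borel_measurable M \<and>
    (\<exists>s. (\<forall>i. Bochner_Integration.simple_bochner_integrable M (s i)) \<and>
      (\<lambda>i::nat. \<integral>\<^sup>+y. ennreal (norm (f y - s i y)) \<partial>M) \<longlonglongrightarrow> 0 \<and>
      (\<lambda>i. Bochner_Integration.simple_bochner_integral M (s i)) \<longlonglongrightarrow> x)"

definition bochner_integrable :: "'a measure \<Rightarrow> ('a \<Rightarrow> 'x::real_normed_vector) \<Rightarrow> bool" where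
  "bochner_integrable M f \<longleftrightarrow> (\<exists>x. has_bochner M f x)"

definition bochner_integral :: "'a measure \<Rightarrow> ('a \<Rightarrow> 'x::real_normed_vector) \<Rightarrow> 'x" where
  "bochner_integral M f = (if bochner_integrable M f then THE x. has_bochner M f x else 0)"

lemma has_bochner_eq_library:
  fixes f :: "'a \<Rightarrow> 'x::{real_normed_vector, second_countable_topology}"
  shows "has_bochner M f x \<longleftrightarrow> has_bochner_integral M f x"
  by (auto simp: has_bochner_def has_bochner_integral.simps)

lemma bochner_integral_eq_library:
  fixes f :: "'a \<Rightarrow> 'x::{real_normed_vector, second_countable_topology}"
  shows "bochner_integrable M f \<longleftrightarrow> integrable M f" "bochner_integral M f = integral\<^sup>L M f"
proof -
  have "has_bochner M f = has_bochner_integral M f"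
    by (rule ext) (rule has_bochner_eq_library)
  then show "bochner_integrable M f \<longleftrightarrow> integrable M f" "bochner_integral M f = integral\<^sup>L M f"
    by (simp_all add: bochner_integrable_def bochner_integral_def lebesgue_integral_def
        integrable.simps)
qed

text \<open>
  \<^const>\<open>Bcontfun\<close> is meaningful only on bounded continuous functions; that the integral is
  such a function of \<open>t\<close> is equivalent to \<open>H_C W R \<omega> f\<close> having the integral as its value at every
  point.
\<close>

definition H_C ::
    "'th measure \<Rightarrow> ('x \<times> 'th \<Rightarrow> 'x) \<Rightarrow> ('t \<times> 'th \<Rightarrow> 't)
      \<Rightarrow> ('t::metric_space \<Rightarrow>\<^sub>C 'x::banach) \<Rightarrow> ('t \<Rightarrow>\<^sub>C 'x)" where
  "H_C W R \<omega> f =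
    Bcontfun (\<lambda>t. bochner_integral W (\<lambda>\<theta>. R (apply_bcontfun f (\<omega> (t, \<theta>)), \<theta>)))"

end

theory Submission
  imports Defs
begin

text \<open>
  Every assertion about \<^const>\<open>H_C\<close> comes from the integral being additive, commuting with
  bounded linear maps, and satisfying
  \<open>norm (\<integral> f) \<le> \<integral> b\<close> whenever \<open>norm f \<le> b\<close> with \<open>b\<close> measurable.
  Applied to \<open>\<theta> \<mapsto> R (f (\<omega> (t, \<theta>)), \<theta>)\<close>, which depends linearly on \<open>f\<close> and has norm at most
  \<open>onorm R\<^sub>\<theta> * norm f\<close>, these facts give linearity and
  \<open>norm (H_C f) \<le> (\<integral> onorm R\<^sub>\<theta>) * norm f\<close>, hence continuity and the bound on the operator norm.

  The space \<open>X\<close> may be non-separable, and then sums and differences of Borel functions with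
  values in \<open>X\<close> need not be Borel. This causes trouble at two places.

  Firstly, the difference of two Bochner integrable functions need not be measurable, so even
  uniqueness of the integral does not follow by subtracting. The remedy is the relation
  \<^term>\<open>L1_simple_limit\<close>, which keeps the approximation by simple functions and replaces
  measurability of the integrand by measurable majorants of the errors. It contains the Bochner
  integral (\<open>L1_simple_limit_bochner_integral\<close>), is linear (\<open>L1_simple_limit_add\<close>,
  \<open>L1_simple_limit_bounded_linear\<close>) and obeys the norm estimate
  (\<open>L1_simple_limit_norm_le\<close>).

  Secondly, the integral must be continuous in \<open>t\<close>. Along a sequence \<open>x\<^sub>n \<longlonglongrightarrow> t\<close> the difference
  of the integrals is at most
  \<open>\<integral> onorm R\<^sub>\<theta> * dist (f (\<omega> (x\<^sub>n, \<theta>))) (f (\<omega> (t, \<theta>)))\<close>, which tends to zero by dominated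
  convergence, because \<open>f\<close> is bounded and continuous and \<open>\<omega>\<close> is continuous in \<open>t\<close>. The integrand is measurable
  because \<open>f\<close> has compact, hence separable, range (\<open>borel_measurable_dist_compact\<close>).
\<close>

section \<open>Integrals as limits of simple functions\<close>

text \<open>
  The functions \<open>e i\<close> bound the errors from above, since the nonnegative integral of a
  non-measurable function is only a lower integral, which is not subadditive. With measurable
  majorants the relation is closed under sums even where the sum of the integrands is not Borel.
\<close>

definition L1_simple_limit :: "'a measure \<Rightarrow> ('a \<Rightarrow> 'x::real_normed_vector) \<Rightarrow> 'x \<Rightarrow> bool" where
  "L1_simple_limit M f x \<longleftrightarrow> (\<exists>s (e :: nat \<Rightarrow> 'a \<Rightarrow> ennreal).
    (\<forall>i. Bochner_Integration.simple_bochner_integrable M (s i)) \<and>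
    (\<forall>i. e i \<in> borel_measurable M) \<and>
    (\<forall>i. \<forall>y\<in>space M. ennreal (norm (f y - s i y)) \<le> e i y) \<and>
    (\<lambda>i. \<integral>\<^sup>+y. e i y \<partial>M) \<longlonglongrightarrow> 0 \<and>
    (\<lambda>i. Bochner_Integration.simple_bochner_integral M (s i)) \<longlonglongrightarrow> x)"

lemma L1_simple_limitI:
  fixes e :: "nat \<Rightarrow> 'a \<Rightarrow> ennreal"
  assumes "\<And>i. Bochner_Integration.simple_bochner_integrable M (s i)"
    and "\<And>i. e i \<in> borel_measurable M"
    and "\<And>i y. y \<in> space M \<Longrightarrow> ennreal (norm (f y - s i y)) \<le> e i y"
    and "(\<lambda>i. \<integral>\<^sup>+y. e i y \<partial>M) \<longlonglongrightarrow> 0"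
    and "(\<lambda>i. Bochner_Integration.simple_bochner_integral M (s i)) \<longlonglongrightarrow> x"
  shows "L1_simple_limit M f x"
  unfolding L1_simple_limit_def using assms by blast

lemma L1_simple_limitE:
  assumes "L1_simple_limit M f x"
  obtains s and e :: "nat \<Rightarrow> 'a \<Rightarrow> ennreal" where
    "\<And>i. Bochner_Integration.simple_bochner_integrable M (s i)"
    "\<And>i. e i \<in> borel_measurable M"
    "\<And>i y. y \<in> space M \<Longrightarrow> ennreal (norm (f y - s i y)) \<le> e i y"
    "(\<lambda>i. \<integral>\<^sup>+y. e i y \<partial>M) \<longlonglongrightarrow> 0"
    "(\<lambda>i. Bochner_Integration.simple_bochner_integral M (s i)) \<longlonglongrightarrow> x"
  using assms unfolding L1_simple_limit_def by blast

text \<open>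
  Subtracting a simple function does no harm to measurability in a non-separable space: on each of
  the finitely many level sets of \<open>s\<close> a constant is subtracted.
\<close>

lemma borel_measurable_norm_diff_simple:
  fixes f :: "'a \<Rightarrow> 'x::real_normed_vector"
  assumes f: "f \<in> borel_measurable M" and s: "simple_function M s"
  shows "(\<lambda>y. norm (f y - s y)) \<in> borel_measurable M"
proof (rule measurable_compose_countable'[where f = "\<lambda>c y. norm (f y - c)" and g = s
      and I = "s ` space M"])
  show "s \<in> measurable M (count_space (s ` space M))"
    using s by (auto simp: simple_function_def measurable_count_space_eq2)
  show "countable (s ` space M)"
    using s by (simp add: simple_function_def countable_finite)
  show "(\<lambda>y. norm (f y - c)) \<in> borel_measurable M" for c
    by (rule measurable_compose[OF f])
      (intro borel_measurable_continuous_onI continuous_intros)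
qed

lemma has_bochner_imp_L1_simple_limit:
  assumes "has_bochner M f x"
  shows "L1_simple_limit M f x"
proof -
  from assms obtain s where f: "f \<in> borel_measurable M"
    and s: "\<And>i. Bochner_Integration.simple_bochner_integrable M (s i)"
    and l: "(\<lambda>i::nat. \<integral>\<^sup>+y. ennreal (norm (f y - s i y)) \<partial>M) \<longlonglongrightarrow> 0"
      "(\<lambda>i. Bochner_Integration.simple_bochner_integral M (s i)) \<longlonglongrightarrow> x"
    unfolding has_bochner_def by blast
  have "(\<lambda>y. ennreal (norm (f y - s i y))) \<in> borel_measurable M" for i
    using borel_measurable_norm_diff_simple[OF f, of "s i"] s[of i]
    by (auto elim: simple_bochner_integrable.cases)
  then show ?thesis
    by (intro L1_simple_limitI[OF s _ _ l]) auto
qed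

lemma L1_simple_limit_add:
  assumes "L1_simple_limit M f x" "L1_simple_limit M g y"
  shows "L1_simple_limit M (\<lambda>z. f z + g z) (x + y)"
proof -
  obtain s e where s: "\<And>i. Bochner_Integration.simple_bochner_integrable M (s i)"
    and e[measurable]: "\<And>i. e i \<in> borel_measurable M"
    and se: "\<And>i z. z \<in> space M \<Longrightarrow> ennreal (norm (f z - s i z)) \<le> e i z"
    and le: "(\<lambda>i. \<integral>\<^sup>+z. e i z \<partial>M) \<longlonglongrightarrow> 0"
    and ls: "(\<lambda>i. Bochner_Integration.simple_bochner_integral M (s i)) \<longlonglongrightarrow> x"
    by (rule L1_simple_limitE[OF assms(1)]) (rule that)
  obtain t d where t: "\<And>i. Bochner_Integration.simple_bochner_integrable M (t i)"
    and d[measurable]: "\<And>i. d i \<in> borel_measurable M"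
    and td: "\<And>i z. z \<in> space M \<Longrightarrow> ennreal (norm (g z - t i z)) \<le> d i z"
    and ld: "(\<lambda>i. \<integral>\<^sup>+z. d i z \<partial>M) \<longlonglongrightarrow> 0"
    and lt: "(\<lambda>i. Bochner_Integration.simple_bochner_integral M (t i)) \<longlonglongrightarrow> y"
    by (rule L1_simple_limitE[OF assms(2)]) (rule that)
  show ?thesis
  proof (rule L1_simple_limitI)
    show "Bochner_Integration.simple_bochner_integrable M (\<lambda>z. s i z + t i z)" for i
      by (rule simple_bochner_integrable_compose2[where p = "(+)"]) (simp_all add: s t)
    show "(\<lambda>z. e i z + d i z) \<in> borel_measurable M" for i
      by measurable
    show "ennreal (norm (f z + g z - (s i z + t i z))) \<le> e i z + d i z" if "z \<in> space M" for i z
    proof -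
      have "norm (f z + g z - (s i z + t i z)) \<le> norm (f z - s i z) + norm (g z - t i z)"
        by (rule norm_diff_triangle_ineq)
      then have "ennreal (norm (f z + g z - (s i z + t i z)))
          \<le> ennreal (norm (f z - s i z)) + ennreal (norm (g z - t i z))"
        by (simp flip: ennreal_plus)
      also have "\<dots> \<le> e i z + d i z"
        by (intro add_mono se td that)
      finally show ?thesis .
    qed
    show "(\<lambda>i. \<integral>\<^sup>+z. e i z + d i z \<partial>M) \<longlonglongrightarrow> 0"
      using tendsto_add[OF le ld] by (simp add: nn_integral_add)
    show "(\<lambda>i. Bochner_Integration.simple_bochner_integral M (\<lambda>z. s i z + t i z)) \<longlonglongrightarrow> x + y"
      using tendsto_add[OF ls lt] by (simp add: simple_bochner_integral_add s t)
  qed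
qed

lemma L1_simple_limit_bounded_linear:
  assumes A: "bounded_linear A" and "L1_simple_limit M f x"
  shows "L1_simple_limit M (\<lambda>z. A (f z)) (A x)"
proof -
  interpret A: bounded_linear A by (rule A)
  obtain s e where s: "\<And>i. Bochner_Integration.simple_bochner_integrable M (s i)"
    and e[measurable]: "\<And>i. e i \<in> borel_measurable M"
    and se: "\<And>i z. z \<in> space M \<Longrightarrow> ennreal (norm (f z - s i z)) \<le> e i z"
    and le: "(\<lambda>i. \<integral>\<^sup>+z. e i z \<partial>M) \<longlonglongrightarrow> 0"
    and ls: "(\<lambda>i. Bochner_Integration.simple_bochner_integral M (s i)) \<longlonglongrightarrow> x"
    by (rule L1_simple_limitE[OF assms(2)]) (rule that)
  show ?thesis
  proof (rule L1_simple_limitI)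
    show "Bochner_Integration.simple_bochner_integrable M (\<lambda>z. A (s i z))" for i
      using simple_bochner_integrable_compose2[where p = "\<lambda>u v. A u", OF _ s s] by (simp add: A.zero)
    show "(\<lambda>z. ennreal (onorm A) * e i z) \<in> borel_measurable M" for i
      by measurable
    show "ennreal (norm (A (f z) - A (s i z))) \<le> ennreal (onorm A) * e i z"
      if "z \<in> space M" for i z
    proof -
      have "ennreal (norm (A (f z) - A (s i z))) \<le> ennreal (onorm A * norm (f z - s i z))"
        unfolding A.diff[symmetric] by (intro ennreal_leI onorm A)
      also have "\<dots> = ennreal (onorm A) * ennreal (norm (f z - s i z))"
        by (simp add: ennreal_mult onorm_pos_le A)
      also have "\<dots> \<le> ennreal (onorm A) * e i z"
        by (intro mult_left_mono se that) simp
      finally show ?thesis .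
    qed
    show "(\<lambda>i. \<integral>\<^sup>+z. ennreal (onorm A) * e i z \<partial>M) \<longlonglongrightarrow> 0"
      using ennreal_tendsto_cmult[OF _ le, of "ennreal (onorm A)"] by (simp add: nn_integral_cmult)
    show "(\<lambda>i. Bochner_Integration.simple_bochner_integral M (\<lambda>z. A (s i z))) \<longlonglongrightarrow> A x"
      using A.tendsto[OF ls]
      by (simp add: simple_bochner_integral_linear[OF A.linear_axioms s])
  qed
qed

lemma L1_simple_limit_diff:
  assumes "L1_simple_limit M f x" "L1_simple_limit M g y"
  shows "L1_simple_limit M (\<lambda>z. f z - g z) (x - y)"
  using L1_simple_limit_add[OF assms(1)
      L1_simple_limit_bounded_linear[OF bounded_linear_minus[OF bounded_linear_ident] assms(2)]]
  by simp

text \<open>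
  The simple approximants satisfy \<open>norm (s i) \<le> b + e i\<close>, and the triangle inequality is available
  for their integrals, which are finite sums; the errors vanish in the limit. Only the majorant has
  to be measurable, so the estimate applies to differences of Bochner integrable functions.
\<close>

lemma L1_simple_limit_norm_le:
  assumes "L1_simple_limit M f x"
    and b[measurable]: "b \<in> borel_measurable M"
    and fb: "\<And>z. z \<in> space M \<Longrightarrow> ennreal (norm (f z)) \<le> b z"
  shows "ennreal (norm x) \<le> (\<integral>\<^sup>+z. b z \<partial>M)"
proof -
  obtain s e where s: "\<And>i. Bochner_Integration.simple_bochner_integrable M (s i)"
    and e[measurable]: "\<And>i. e i \<in> borel_measurable M"
    and se: "\<And>i z. z \<in> space M \<Longrightarrow> ennreal (norm (f z - s i z)) \<le> e i z"
    and le: "(\<lambda>i. \<integral>\<^sup>+z. e i z \<partial>M) \<longlonglongrightarrow> 0"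
    and ls: "(\<lambda>i. Bochner_Integration.simple_bochner_integral M (s i)) \<longlonglongrightarrow> x"
    by (rule L1_simple_limitE[OF assms(1)]) (rule that)
  have bound: "ennreal (norm (Bochner_Integration.simple_bochner_integral M (s i)))
      \<le> (\<integral>\<^sup>+z. b z \<partial>M) + (\<integral>\<^sup>+z. e i z \<partial>M)" for i
  proof -
    have "ennreal (norm (Bochner_Integration.simple_bochner_integral M (s i)))
        \<le> ennreal (Bochner_Integration.simple_bochner_integral M (\<lambda>z. norm (s i z)))"
      by (intro ennreal_leI simple_bochner_integral_norm_bound s)
    also have "\<dots> = (\<integral>\<^sup>+z. ennreal (norm (s i z)) \<partial>M)"
      using simple_bochner_integrable_compose2[where p = "\<lambda>u v. norm u", OF _ s s]
      by (intro simple_bochner_integral_eq_nn_integral) simp_all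
    also have "\<dots> \<le> (\<integral>\<^sup>+z. b z + e i z \<partial>M)"
    proof (rule nn_integral_mono)
      fix z assume z: "z \<in> space M"
      have "norm (s i z) \<le> norm (f z) + norm (f z - s i z)"
        using norm_triangle_ineq4[of "f z" "f z - s i z"] by simp
      then have "ennreal (norm (s i z)) \<le> ennreal (norm (f z)) + ennreal (norm (f z - s i z))"
        by (simp flip: ennreal_plus)
      also have "\<dots> \<le> b z + e i z"
        by (intro add_mono fb se z)
      finally show "ennreal (norm (s i z)) \<le> b z + e i z" .
    qed
    also have "\<dots> = (\<integral>\<^sup>+z. b z \<partial>M) + (\<integral>\<^sup>+z. e i z \<partial>M)"
      by (simp add: nn_integral_add)
    finally show ?thesis .
  qed
  have "(\<lambda>i. ennreal (norm (Bochner_Integration.simple_bochner_integral M (s i))))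
      \<longlonglongrightarrow> ennreal (norm x)"
    by (intro tendsto_ennrealI tendsto_norm ls)
  moreover have "(\<lambda>i. (\<integral>\<^sup>+z. b z \<partial>M) + (\<integral>\<^sup>+z. e i z \<partial>M)) \<longlonglongrightarrow> (\<integral>\<^sup>+z. b z \<partial>M)"
    using tendsto_add[OF tendsto_const le] by simp
  ultimately show ?thesis
    by (rule LIMSEQ_le) (use bound in blast)
qed

text \<open>
  The difference of the two functions vanishes, so its limit has norm at most the integral of the
  zero function. This identifies the values of \<^const>\<open>H_C\<close> at sums and scalar multiples.
\<close>

lemma L1_simple_limit_unique:
  assumes "L1_simple_limit M f x" "L1_simple_limit M g y"
    and "\<And>z. z \<in> space M \<Longrightarrow> f z = g z"
  shows "x = y"
  using L1_simple_limit_norm_le[OF L1_simple_limit_diff[OF assms(1,2)], of "\<lambda>z. 0"] assms(3)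
  by simp

lemma L1_simple_limit_bochner_integral:
  assumes "bochner_integrable M f"
  shows "L1_simple_limit M f (bochner_integral M f)"
proof -
  obtain x where x: "has_bochner M f x"
    using assms by (auto simp: bochner_integrable_def)
  have "y = x" if "has_bochner M f y" for y
    by (rule L1_simple_limit_unique[OF that[THEN has_bochner_imp_L1_simple_limit]
          x[THEN has_bochner_imp_L1_simple_limit] refl])
  with x have "(THE y. has_bochner M f y) = x"
    by (rule the_equality)
  then have "bochner_integral M f = x"
    using assms by (simp add: bochner_integral_def)
  then show ?thesis
    using has_bochner_imp_L1_simple_limit[OF x] by simp
qed

section \<open>Distances between functions with compact range\<close>

lemma compact_countable_dense:
  fixes C :: "'a::metric_space set"
  assumes "compact C"
  obtains D where "countable D" "\<And>x e. x \<in> C \<Longrightarrow> 0 < e \<Longrightarrow> \<exists>d\<in>D. dist x d < e"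
proof -
  have "\<exists>k. finite k \<and> C \<subseteq> (\<Union>x\<in>k. ball x (inverse (Suc n)))" for n :: nat
    using assms unfolding compact_eq_totally_bounded by simp
  then obtain k where k: "\<And>n. finite (k n)" "\<And>n. C \<subseteq> (\<Union>x\<in>k n. ball x (inverse (Suc n)))"
    by metis
  show thesis
  proof
    show "countable (\<Union>n. k n)"
      using k(1) by (auto intro: countable_finite)
    fix x and e :: real
    assume "x \<in> C" "0 < e"
    obtain n where "inverse (Suc n) < e"
      using reals_Archimedean[OF \<open>0 < e\<close>] by auto
    moreover obtain d where "d \<in> k n" "dist d x < inverse (Suc n)"
      using k(2)[of n] \<open>x \<in> C\<close> by auto
    ultimately show "\<exists>d\<in>\<Union>n. k n. dist x d < e"
      by (force simp: dist_commute)
  qed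
qed

text \<open>
  In a non-separable space the pair \<open>(u, v)\<close> need not be measurable for the Borel sets of the product
  space. It suffices that one of the functions has values in a separable set: then the distance is
  the infimum over a countable dense subset \<open>D\<close> of the lengths \<open>dist (u z) d + dist (v z) d\<close> of
  detours, each of which is measurable in \<open>z\<close>.
\<close>

lemma borel_measurable_dist_compact:
  fixes u v :: "'a \<Rightarrow> 'x::metric_space"
  assumes u: "u \<in> borel_measurable M" and v: "v \<in> borel_measurable M"
    and C: "compact C" "u ` space M \<subseteq> C"
  shows "(\<lambda>z. dist (u z) (v z)) \<in> borel_measurable M"
proof -
  obtain D where D: "countable D" "\<And>x e. x \<in> C \<Longrightarrow> 0 < e \<Longrightarrow> \<exists>d\<in>D. dist x d < e"
    using compact_countable_dense[OF C(1)] by blast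
  have meas[measurable]: "(\<lambda>z. dist (w z) d) \<in> borel_measurable M" if "w \<in> borel_measurable M"
    for w and d :: 'x
    by (rule measurable_compose[OF that])
      (intro borel_measurable_continuous_onI continuous_intros)
  have "{z \<in> space M. dist (u z) (v z) < a} \<in> sets M" for a
  proof -
    have "{z \<in> space M. dist (u z) (v z) < a} =
        (\<Union>d\<in>D. {z \<in> space M. dist (u z) d + dist (v z) d < a})" (is "?L = ?R")
    proof
      show "?R \<subseteq> ?L"
        using dist_triangle2 by (auto intro: le_less_trans)
      show "?L \<subseteq> ?R"
      proof
        fix z assume z: "z \<in> ?L"
        \<comment> \<open>A detour through \<open>d\<close> is longer than the direct way by at most \<open>2 * dist (u z) d\<close>.\<close>
        then obtain d where "d \<in> D" and d: "dist (u z) d < (a - dist (u z) (v z)) / 2"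
          using D(2)[of "u z" "(a - dist (u z) (v z)) / 2"] C(2) by auto
        have "dist (v z) d \<le> dist (u z) (v z) + dist (u z) d"
          using dist_triangle3[of "v z" d "u z"] by (simp add: dist_commute)
        with d have "dist (u z) d + dist (v z) d < a"
          by (simp add: field_simps)
        with \<open>d \<in> D\<close> z show "z \<in> ?R"
          by auto
      qed
    qed
    also have "\<dots> \<in> sets M"
    proof (rule sets.countable_UN'[OF D(1)])
      show "(\<lambda>d. {z \<in> space M. dist (u z) d + dist (v z) d < a}) ` D \<subseteq> sets M" 
        using u v by auto
    qed
    finally show ?thesis .
  qed
  then show ?thesis
    by (subst borel_measurable_iff_less) blast
qed

section \<open>Linear maps over the scalar field\<close>

lemma continuous_linear_imp_bounded_linear:
  fixes h :: "'a::real_normed_vector \<Rightarrow> 'b::real_normed_vector"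
  assumes "linear h" "continuous_on UNIV h"
  shows "bounded_linear h"
proof -
  interpret linear h by fact
  have "isCont h 0"
    using assms(2) by (simp add: continuous_on_eq_continuous_at)
  then obtain d where d: "d > 0" "\<And>x. norm x < d \<Longrightarrow> norm (h x) < 1"
    unfolding continuous_at_eps_delta using zero_less_one
    by (metis dist_0_norm dist_commute zero)
  show ?thesis
  proof (rule bounded_linear_intro[where K = "2 / d"])
    fix x
    show "norm (h x) \<le> norm x * (2 / d)"
    proof (cases "x = 0")
      case False
      \<comment> \<open>The factor \<open>c\<close> scales \<open>x\<close> to norm \<open>d / 2\<close>, inside the ball where \<open>h\<close> is bounded by 1.\<close>
      define c where "c = d / (2 * norm x)"
      have c: "c > 0"
        using d(1) False by (simp add: c_def)
      have "norm (c *\<^sub>R x) < d"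
        using d(1) False by (simp add: c_def)
      then have "c * norm (h x) < 1"
        using d(2)[of "c *\<^sub>R x"] c by (simp add: scale)
      then show ?thesis
        using d(1) False by (simp add: c_def field_simps)
    qed (simp add: zero)
  qed (simp_all add: add scale)
qed

lemma linear_over_imp_linear:
  assumes "linear_over K sa sb h" "\<real> \<subseteq> K"
    and "\<And>r x. sa (of_real r) x = r *\<^sub>R x" "\<And>r x. sb (of_real r) x = r *\<^sub>R x"
  shows "linear h"
proof (rule linearI)
  show "h (x + y) = h x + h y" for x y
    using assms(1) by (simp add: linear_over_def)
  show "h (r *\<^sub>R x) = r *\<^sub>R h x" for r x
  proof -
    have "complex_of_real r \<in> K"
      using assms(2) by auto
    then have "h (sa (of_real r) x) = sb (of_real r) (h x)"
      using assms(1) by (simp add: linear_over_def)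
    then show ?thesis
      by (simp add: assms(3,4))
  qed
qed

context hilbert_space_over
begin

lemma Reals_subset: "\<real> \<subseteq> K"
  using K_real_or_complex by auto

lemma bounded_linear_smul:
  assumes a: "a \<in> K"
  shows "bounded_linear (smul a)"
proof (rule bounded_linear_intro[where K = "cmod a"])
  show "smul a (r *\<^sub>R x) = r *\<^sub>R smul a x" for r x
  proof -
    have r: "of_real r \<in> K"
      using Reals_subset by auto
    show ?thesis
      using scale_scale[OF a r, of x] scale_scale[OF r a, of x]
      by (simp add: scale_of_real mult.commute)
  qed
qed (auto simp: scale_add_right[OF a] norm_scale[OF a] mult.commute)

lemma scaleC_of_real: "scaleC smul (of_real r) f = r *\<^sub>R f"
  by (rule bcontfun_eqI) (simp add: apply_scaleC subsetD[OF Reals_subset] scale_of_real)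

end

section \<open>The integral operator\<close>

text \<open>
  Two distinct points are needed: over a one-point space the supremum ranges over the empty set
  and has an unspecified value.
\<close>

lemma lipschitz_const_nonneg:
  fixes h :: "'t::metric_space \<Rightarrow> 't"
  assumes "L-lipschitz_on UNIV h" "\<exists>s t :: 't. s \<noteq> t"
  shows "0 \<le> lipschitz_const h"
proof -
  obtain s t :: 't where st: "s \<noteq> t"
    using assms(2) by blast
  have "0 \<le> dist (h s) (h t) / dist s t"
    by simp
  also have "\<dots> \<le> lipschitz_const h"
    unfolding lipschitz_const_def
  proof (rule cSUP_upper2[where x = "(s, t)"])
    show "bdd_above ((\<lambda>(s, t). dist (h s) (h t) / dist s t) ` {(s, t). s \<noteq> t})"
      using lipschitz_onD[OF assms(1)] by (intro bdd_aboveI[where M = L]) (auto simp: field_simps)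
  qed (use st in auto)
  finally show ?thesis .
qed

text \<open>
  Dominated convergence along sequences, applied to the real functions \<open>b n\<close> that bound the
  norms of the differences of the integrands; the diameter bound \<open>B\<close> of \<open>C\<close> times the operator norm
  is the integrable majorant.
\<close>

lemma continuous_bochner_integral_compact_range:
  fixes R :: "'x::banach \<times> 'th \<Rightarrow> 'x" and g :: "'t::metric_space \<Rightarrow> 'th \<Rightarrow> 'x"
  assumes R: "\<And>\<theta>. \<theta> \<in> space W \<Longrightarrow> bounded_linear (\<lambda>x. R (x, \<theta>))"
    and onorm_meas[measurable]: "(\<lambda>\<theta>. onorm (\<lambda>x. R (x, \<theta>))) \<in> borel_measurable W"
    and fin: "(\<integral>\<^sup>+\<theta>. ennreal (onorm (\<lambda>x. R (x, \<theta>))) \<partial>W) < \<infinity>"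
    and int: "\<And>t. bochner_integrable W (\<lambda>\<theta>. R (g t \<theta>, \<theta>))"
    and g_meas: "\<And>t. g t \<in> borel_measurable W"
    and C: "compact C" "\<And>t \<theta>. \<theta> \<in> space W \<Longrightarrow> g t \<theta> \<in> C"
    and g_cont: "\<And>\<theta>. \<theta> \<in> space W \<Longrightarrow> continuous_on UNIV (\<lambda>t. g t \<theta>)"
  shows "continuous_on UNIV (\<lambda>t. bochner_integral W (\<lambda>\<theta>. R (g t \<theta>, \<theta>)))"
    (is "continuous_on UNIV ?I")
proof -
  define N where "N \<theta> = onorm (\<lambda>x. R (x, \<theta>))" for \<theta>
  note [measurable] = onorm_meas[folded N_def]
  have "(?I \<circ> x) \<longlonglongrightarrow> ?I t" if x: "x \<longlonglongrightarrow> t" for x t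
  proof -
    define b where "b n \<theta> = N \<theta> * dist (g (x n) \<theta>) (g t \<theta>)" for n \<theta>
    obtain B where B: "\<And>y z. y \<in> C \<Longrightarrow> z \<in> C \<Longrightarrow> dist y z \<le> B"
      using compact_imp_bounded[OF C(1)] by (metis bounded_two_points)
    have [measurable]: "(\<lambda>\<theta>. dist (g (x n) \<theta>) (g t \<theta>)) \<in> borel_measurable W" for n
      using C by (intro borel_measurable_dist_compact[of _ _ _ C] g_meas) auto
    have b_meas[measurable]: "b n \<in> borel_measurable W" for n
      unfolding b_def by measurable
    have N0: "0 \<le> N \<theta>" if "\<theta> \<in> space W" for \<theta>
      unfolding N_def by (rule onorm_pos_le[OF R[OF that]])
    have "(\<lambda>n. \<integral>\<^sup>+\<theta>. ennreal (b n \<theta>) \<partial>W) \<longlonglongrightarrow> (\<integral>\<^sup>+\<theta>. 0 \<partial>W)"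
    proof (rule nn_integral_dominated_convergence[where w = "\<lambda>\<theta>. ennreal B * ennreal (N \<theta>)"])
      show "AE \<theta> in W. ennreal (b n \<theta>) \<le> ennreal B * ennreal (N \<theta>)" for n
      proof (rule AE_I2)
        fix \<theta> assume \<theta>: "\<theta> \<in> space W"
        have d: "dist (g (x n) \<theta>) (g t \<theta>) \<le> B"
          by (intro B C(2) \<theta>)
        then have "0 \<le> B"
          using zero_le_dist order_trans by blast
        have "b n \<theta> \<le> N \<theta> * B"
          unfolding b_def by (intro mult_left_mono d N0 \<theta>)
        then show "ennreal (b n \<theta>) \<le> ennreal B * ennreal (N \<theta>)"
          using \<open>0 \<le> B\<close> N0[OF \<theta>] by (simp add: ennreal_leI mult.commute flip: ennreal_mult)
      qed
      show "(\<integral>\<^sup>+\<theta>. ennreal B * ennreal (N \<theta>) \<partial>W) < \<infinity>"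
        using fin by (simp add: nn_integral_cmult ennreal_mult_less_top N_def[symmetric])
      show "AE \<theta> in W. (\<lambda>n. ennreal (b n \<theta>)) \<longlonglongrightarrow> 0"
      proof (rule AE_I2)
        fix \<theta> assume "\<theta> \<in> space W"
        then have "(\<lambda>n. g (x n) \<theta>) \<longlonglongrightarrow> g t \<theta>"
          using g_cont x continuous_on_tendsto_compose[of UNIV "\<lambda>t. g t \<theta>" x t] by simp
        then have "(\<lambda>n. dist (g (x n) \<theta>) (g t \<theta>)) \<longlonglongrightarrow> 0"
          by (simp add: tendsto_dist_iff[symmetric])
        then have "(\<lambda>n. b n \<theta>) \<longlonglongrightarrow> 0"
          unfolding b_def by (rule tendsto_mult_right_zero)
        then show "(\<lambda>n. ennreal (b n \<theta>)) \<longlonglongrightarrow> 0"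
          using tendsto_ennrealI by fastforce
      qed
    qed measurable
    then have lim: "(\<lambda>n. \<integral>\<^sup>+\<theta>. ennreal (b n \<theta>) \<partial>W) \<longlonglongrightarrow> 0"
      by simp
    have bound: "ennreal (norm (?I (x n) - ?I t)) \<le> (\<integral>\<^sup>+\<theta>. ennreal (b n \<theta>) \<partial>W)" for n
    proof (rule L1_simple_limit_norm_le[OF
          L1_simple_limit_diff[OF int[THEN L1_simple_limit_bochner_integral]
            int[THEN L1_simple_limit_bochner_integral]]])
      fix \<theta> assume "\<theta> \<in> space W"
      then interpret R\<theta>: bounded_linear "\<lambda>x. R (x, \<theta>)"
        by (rule R)
      show "ennreal (norm (R (g (x n) \<theta>, \<theta>) - R (g t \<theta>, \<theta>))) \<le> ennreal (b n \<theta>)"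
        unfolding b_def N_def dist_norm R\<theta>.diff[symmetric]
        by (intro ennreal_leI onorm R\<theta>.bounded_linear_axioms)
    qed simp
    have "(\<lambda>n. ennreal (norm (?I (x n) - ?I t))) \<longlonglongrightarrow> 0"
      by (rule tendsto_sandwich[OF _ _ tendsto_const lim]) (simp_all add: bound)
    then have "(\<lambda>n. norm (?I (x n) - ?I t)) \<longlonglongrightarrow> 0"
      by (simp flip: ennreal_0)
    then show ?thesis
      by (simp add: o_def LIM_zero_iff tendsto_norm_zero_iff)
  qed
  then show ?thesis
    by (simp add: continuous_on_sequentially)
qed

theorem theorem4p1:
  fixes K :: "complex set"
    and smul :: "complex \<Rightarrow> 'x::banach \<Rightarrow> 'x"
    and ip :: "'x \<Rightarrow> 'x \<Rightarrow> complex"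
    and W :: "'th measure"
    and \<omega> :: "'t::metric_space \<times> 'th \<Rightarrow> 't"
    and R :: "'x \<times> 'th \<Rightarrow> 'x"
  assumes X_hilbert: "hilbert_space_over K smul ip"
    and X_nonnull: "\<exists>x::'x. x \<noteq> 0"
    and T_compact: "compact (UNIV :: 't set)"
    and T_two: "\<exists>s t :: 't. s \<noteq> t"
    and omega_measurable: "\<omega> \<in> measurable (borel \<Otimes>\<^sub>M W) borel"
    and R_measurable: "R \<in> measurable (borel \<Otimes>\<^sub>M W) borel"
    and R_linear: "\<And>\<theta>. \<theta> \<in> space W \<Longrightarrow> linear_over K smul smul (\<lambda>x. R (x, \<theta>))"
    and R_continuous: "\<And>\<theta>. \<theta> \<in> space W \<Longrightarrow> continuous_on UNIV (\<lambda>x. R (x, \<theta>))"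
    and omega_lipschitz: "\<And>\<theta>. \<theta> \<in> space W \<Longrightarrow> \<exists>L. L-lipschitz_on UNIV (\<lambda>t. \<omega> (t, \<theta>))"
    and onorm_R_measurable: "(\<lambda>\<theta>. onorm (\<lambda>x. R (x, \<theta>))) \<in> borel_measurable W"
    and finite_integral:
      "(\<integral>\<^sup>+\<theta>. ennreal (onorm (\<lambda>x. R (x, \<theta>)) * (1 + lipschitz_const (\<lambda>t. \<omega> (t, \<theta>)))) \<partial>W) < \<infinity>"
    and pointwise_integrable:
      "\<And>(f :: 't \<Rightarrow>\<^sub>C 'x) t. bochner_integrable W (\<lambda>\<theta>. R (apply_bcontfun f (\<omega> (t, \<theta>)), \<theta>))"
  shows "(\<forall>f t. apply_bcontfun (H_C W R \<omega> f) t =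
             bochner_integral W (\<lambda>\<theta>. R (apply_bcontfun f (\<omega> (t, \<theta>)), \<theta>))) \<and>
         linear_over K (scaleC smul) (scaleC smul) (H_C W R \<omega>) \<and>
         continuous_on UNIV (H_C W R \<omega>) \<and>
         onorm (H_C W R \<omega>) \<le> (\<integral>\<theta>. onorm (\<lambda>x. R (x, \<theta>)) \<partial>W)"
proof -
  interpret X: hilbert_space_over K smul ip by (rule X_hilbert)
  define N where "N \<theta> = onorm (\<lambda>x. R (x, \<theta>))" for \<theta>
  define I where "I f t = bochner_integral W (\<lambda>\<theta>. R (apply_bcontfun f (\<omega> (t, \<theta>)), \<theta>))"
    for f :: "'t \<Rightarrow>\<^sub>C 'x" and t
  have limit: "L1_simple_limit W (\<lambda>\<theta>. R (apply_bcontfun f (\<omega> (t, \<theta>)), \<theta>)) (I f t)" for f t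
    unfolding I_def by (rule L1_simple_limit_bochner_integral[OF pointwise_integrable])
  have R_bounded: "bounded_linear (\<lambda>x. R (x, \<theta>))" if "\<theta> \<in> space W" for \<theta>
    using that
    by (intro continuous_linear_imp_bounded_linear R_continuous
        linear_over_imp_linear[OF R_linear X.Reals_subset] X.scale_of_real)
  have N_meas[measurable]: "N \<in> borel_measurable W"
    using onorm_R_measurable by (simp add: N_def[abs_def])
  have N_nonneg: "0 \<le> N \<theta>" if "\<theta> \<in> space W" for \<theta>
    unfolding N_def by (rule onorm_pos_le[OF R_bounded[OF that]])
  have N_finite: "(\<integral>\<^sup>+\<theta>. ennreal (N \<theta>) \<partial>W) < \<infinity>"
  proof (rule le_less_trans[OF nn_integral_mono finite_integral])
    \<comment> \<open>The nonnegative integral is monotone on arbitrary functions; this matters because nothing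
      above shows that the Lipschitz constant is measurable in \<open>\<theta>\<close>.\<close>
    fix \<theta> assume \<theta>: "\<theta> \<in> space W"
    have "0 \<le> lipschitz_const (\<lambda>t. \<omega> (t, \<theta>))"
      using omega_lipschitz[OF \<theta>] T_two lipschitz_const_nonneg by blast
    then show "ennreal (N \<theta>)
        \<le> ennreal (onorm (\<lambda>x. R (x, \<theta>)) * (1 + lipschitz_const (\<lambda>t. \<omega> (t, \<theta>))))"
      using N_nonneg[OF \<theta>] by (intro ennreal_leI) (simp add: N_def algebra_simps)
  qed
  have N_integral: "(\<integral>\<^sup>+\<theta>. ennreal (N \<theta>) \<partial>W) = ennreal (\<integral>\<theta>. N \<theta> \<partial>W)"
    using N_finite N_nonneg
    by (intro nn_integral_eq_integral integrableI_nonneg AE_I2) simp_all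
  have N_integral_nonneg: "0 \<le> (\<integral>\<theta>. N \<theta> \<partial>W)"
    using N_nonneg by (intro integral_nonneg_AE AE_I2)

  have I_bound: "norm (I f t) \<le> (\<integral>\<theta>. N \<theta> \<partial>W) * norm f" for f t
  proof -
    have "ennreal (norm (I f t)) \<le> (\<integral>\<^sup>+\<theta>. ennreal (norm f) * ennreal (N \<theta>) \<partial>W)"
    proof (rule L1_simple_limit_norm_le[OF limit])
      fix \<theta> assume \<theta>: "\<theta> \<in> space W"
      have "norm (R (apply_bcontfun f (\<omega> (t, \<theta>)), \<theta>)) \<le> N \<theta> * norm (apply_bcontfun f (\<omega> (t, \<theta>)))"
        unfolding N_def by (rule onorm[OF R_bounded[OF \<theta>]])
      also have "\<dots> \<le> N \<theta> * norm f"
        by (intro mult_left_mono norm_bounded N_nonneg \<theta>)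
      finally show "ennreal (norm (R (apply_bcontfun f (\<omega> (t, \<theta>)), \<theta>)))
          \<le> ennreal (norm f) * ennreal (N \<theta>)"
        using N_nonneg[OF \<theta>] by (simp add: ennreal_leI mult.commute flip: ennreal_mult)
    qed simp
    also have "\<dots> = ennreal (norm f * (\<integral>\<theta>. N \<theta> \<partial>W))"
      using N_integral_nonneg by (simp add: nn_integral_cmult N_integral ennreal_mult)
    finally show ?thesis
      using N_integral_nonneg by (simp add: mult.commute)
  qed

  have I_continuous: "continuous_on UNIV (I f)" for f
    unfolding I_def
  proof (rule continuous_bochner_integral_compact_range
      [where C = "range (apply_bcontfun f)", OF R_bounded onorm_R_measurable])
    have f: "continuous_on A (apply_bcontfun f)" for A
      using apply_bcontfun[of f] by (auto simp: bcontfun_def intro: continuous_on_subset)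
    show "compact (range (apply_bcontfun f))"
      by (rule compact_continuous_image[OF f T_compact])
    show "(\<lambda>\<theta>. apply_bcontfun f (\<omega> (t, \<theta>))) \<in> borel_measurable W" for t
      using measurable_compose[OF measurable_compose[OF measurable_Pair1' omega_measurable]
          borel_measurable_continuous_onI[OF f]] by simp
    show "continuous_on UNIV (\<lambda>t. apply_bcontfun f (\<omega> (t, \<theta>)))" if "\<theta> \<in> space W" for \<theta>
      using omega_lipschitz[OF that] lipschitz_on_continuous_on
      by (intro continuous_on_compose2[OF f[of UNIV]]) auto
  qed (use N_finite pointwise_integrable in \<open>simp_all add: N_def\<close>)

  have H_apply: "apply_bcontfun (H_C W R \<omega> f) t = I f t" for f t
  proof -
    have "I f \<in> bcontfun"
      by (rule bcontfun_normI[OF I_continuous I_bound])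
    then show ?thesis
      by (simp add: H_C_def I_def[abs_def] Bcontfun_inverse)
  qed

  have H_linear: "linear_over K (scaleC smul) (scaleC smul) (H_C W R \<omega>)"
    unfolding linear_over_def
  proof (intro conjI allI ballI)
    show "H_C W R \<omega> (f + g) = H_C W R \<omega> f + H_C W R \<omega> g" for f g
    proof (rule bcontfun_eqI)
      fix t
      have "I (f + g) t = I f t + I g t"
        using R_linear
        by (intro L1_simple_limit_unique[OF limit L1_simple_limit_add[OF limit limit]])
          (simp add: linear_over_def)
      then show "apply_bcontfun (H_C W R \<omega> (f + g)) t
          = apply_bcontfun (H_C W R \<omega> f + H_C W R \<omega> g) t"
        by (simp add: H_apply)
    qed
    show "H_C W R \<omega> (scaleC smul a f) = scaleC smul a (H_C W R \<omega> f)" if a: "a \<in> K" for a f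
    proof (rule bcontfun_eqI)
      fix t
      have "I (scaleC smul a f) t = smul a (I f t)"
        using R_linear a
        by (intro L1_simple_limit_unique[OF limit
              L1_simple_limit_bounded_linear[OF X.bounded_linear_smul[OF a] limit]])
          (simp add: linear_over_def X.apply_scaleC)
      then show "apply_bcontfun (H_C W R \<omega> (scaleC smul a f)) t
          = apply_bcontfun (scaleC smul a (H_C W R \<omega> f)) t"
        by (simp add: H_apply X.apply_scaleC a)
    qed
  qed

  have H_bound: "norm (H_C W R \<omega> f) \<le> (\<integral>\<theta>. N \<theta> \<partial>W) * norm f" for f
    by (rule norm_bound) (simp add: H_apply I_bound)
  have "linear (H_C W R \<omega>)"
    by (rule linear_over_imp_linear[OF H_linear X.Reals_subset X.scaleC_of_real X.scaleC_of_real])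
  then have "bounded_linear (H_C W R \<omega>)"
    using H_bound
    by (intro bounded_linear_intro[where K = "\<integral>\<theta>. N \<theta> \<partial>W"])
      (simp_all add: linear_add linear_scale mult.commute)
  then have "continuous_on UNIV (H_C W R \<omega>)"
    by (rule linear_continuous_on)
  moreover have "onorm (H_C W R \<omega>) \<le> (\<integral>\<theta>. N \<theta> \<partial>W)"
    by (rule onorm_bound[OF N_integral_nonneg H_bound])
  ultimately show ?thesis
    using H_apply H_linear by (simp add: I_def N_def)
qed

end
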